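(* Let $\mathcal{A}$ be a commutative unital C*-algebra and let $n$ be a natural number. Let $M,N\in M_n(\mathcal{A})$ be positive matrices. Let $M=AA^*$ and $N=BB^*$ with $A,B\in M_n(\mathcal{A})$, and let $y\in\mathcal{A}^n$ be the vector of row sums of $A\circ B$. Then $$M\circ N\succeq (A\circ B)(A\circ B)^*\succeq\frac1n yy^*.$$
   Context: $M_n(\mathcal{A})$ is the *-algebra of $n\times n$ matrices over $\mathcal{A}$ with the natural matrix operations and involution $[a_{j,k}]^*=[a_{k,j}^*]$. On $\mathcal{A}^n$ (column vectors) use the $\mathcal{A}$-valued inner product $\langle (x_j)_{j=1}^n,(y_j)_{j=1}^n\rangle=\sum_{j=1}^n x_jy_j^*$. A matrix $A\in M_n(\mathcal{A})$ is called positive, written $A\succeq 0$, if $A=A^*$ and $\langle Ax,x\rangle\ge 0$ in $\mathcal{A}$ for all $x\in\mathcal{A}^n$. For matrices $A,B$, one writes $A\succeq B$ if all of $A$, $B$ and $A-B$ are positive. The C*-algebraic Schur product of $A=[a_{j,k}]$ and $B=[b_{j,k}]$ in $M_n(\mathcal{A})$ is $A\circ B=\frac12[a_{j,k}b_{j,k}+b_{j,k}a_{j,k}]_{1\le j,k\le n}$; for commutative $\mathcal{A}$ this equals $[a_{j,k}b_{j,k}]_{1\le j,k\le n}$. The vector of row sums of $C=[c_{j,k}]$ is the column vector with $j$-th entry $\sum_{k=1}^n c_{j,k}$. For a column vector $y$, $yy^*=[y_jy_k^*]_{1\le j,k\le n}$. *)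

theory Defs
  imports "HOL-Analysis.Analysis"
begin

section \<open>Unital C*-algebras\<close>

text \<open>
  The superclass \<^class>\<open>real_normed_algebra_1\<close> supplies the identity, submultiplicativity of the
  norm, and the convention that a unital C*-algebra is nonzero (\<open>0 \<noteq> 1\<close>).
\<close>

class cstar_algebra = real_normed_algebra_1 + banach +
  fixes scaleC :: "complex \<Rightarrow> 'a \<Rightarrow> 'a" (infixr "*\<^sub>C" 75)
    and star :: "'a \<Rightarrow> 'a"
  assumes scaleC_add_right: "c *\<^sub>C (x + y) = c *\<^sub>C x + c *\<^sub>C y"
    and scaleC_add_left: "(c + d) *\<^sub>C x = c *\<^sub>C x + d *\<^sub>C x"
    and scaleC_scaleC: "c *\<^sub>C (d *\<^sub>C x) = (c * d) *\<^sub>C x"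
    and scaleR_scaleC: "r *\<^sub>R x = complex_of_real r *\<^sub>C x"
    and mult_scaleC_left: "(c *\<^sub>C x) * y = c *\<^sub>C (x * y)"
    and mult_scaleC_right: "x * (c *\<^sub>C y) = c *\<^sub>C (x * y)"
    and norm_scaleC: "norm (c *\<^sub>C x) = cmod c * norm x"
    and star_star: "star (star x) = x"
    and star_add: "star (x + y) = star x + star y"
    and star_scaleC: "star (c *\<^sub>C x) = cnj c *\<^sub>C star x"
    and star_mult: "star (x * y) = star y * star x"
    and cstar_identity: "norm (star x * x) = (norm x)\<^sup>2"

class comm_cstar_algebra = cstar_algebra + comm_ring_1

instantiation complex :: comm_cstar_algebra
begin

definition scaleC_complex :: "complex \<Rightarrow> complex \<Rightarrow> complex"
  where "scaleC_complex c x = c * x"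

definition star_complex :: "complex \<Rightarrow> complex"
  where "star_complex x = cnj x"

instance
  by standard
    (simp_all add: scaleC_complex_def star_complex_def algebra_simps scaleR_conv_of_real
      norm_mult power2_eq_square)

end

definition spectrum :: "'a::cstar_algebra \<Rightarrow> complex set"
  where "spectrum a =
    {z. \<not> (\<exists>b. (a - z *\<^sub>C 1) * b = 1 \<and> b * (a - z *\<^sub>C 1) = 1)}"

definition positive_elem :: "'a::cstar_algebra \<Rightarrow> bool"
  where "positive_elem a \<longleftrightarrow> star a = a \<and> spectrum a \<subseteq> \<real>\<^sub>\<ge>\<^sub>0"


section \<open>Matrices over a C*-algebra\<close>

definition inner_A :: "'a::cstar_algebra ^ 'n \<Rightarrow> 'a ^ 'n \<Rightarrow> 'a"
  where "inner_A x y = (\<Sum>j\<in>UNIV. x $ j * star (y $ j))"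

definition mat_star :: "'a::cstar_algebra ^ 'n ^ 'n \<Rightarrow> 'a ^ 'n ^ 'n"
  where "mat_star A = (\<chi> j k. star (A $ k $ j))"

definition positive_mat :: "'a::cstar_algebra ^ 'n ^ 'n \<Rightarrow> bool"
  where "positive_mat A \<longleftrightarrow>
    A = mat_star A \<and> (\<forall>x. positive_elem (inner_A (A *v x) x))"

text \<open>By definition, \<open>A \<succeq> B\<close> also asserts that \<open>A\<close> and \<open>B\<close> are themselves positive.\<close>

definition mat_succeq :: "'a::cstar_algebra ^ 'n ^ 'n \<Rightarrow> 'a ^ 'n ^ 'n \<Rightarrow> bool" (infix "\<succeq>" 50)
  where "A \<succeq> B \<longleftrightarrow> positive_mat A \<and> positive_mat B \<and> positive_mat (A - B)"

definition schur_prod ::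
    "'a::cstar_algebra ^ 'n ^ 'n \<Rightarrow> 'a ^ 'n ^ 'n \<Rightarrow> 'a ^ 'n ^ 'n" (infixl "\<circ>\<^sub>S" 70)
  where "A \<circ>\<^sub>S B =
    (1 / 2) *\<^sub>R (\<chi> j k. A $ j $ k * B $ j $ k + B $ j $ k * A $ j $ k)"

definition row_sums :: "'a::cstar_algebra ^ 'n ^ 'n \<Rightarrow> 'a ^ 'n"
  where "row_sums C = (\<chi> j. \<Sum>k\<in>UNIV. C $ j $ k)"

definition vec_vec_star :: "'a::cstar_algebra ^ 'n \<Rightarrow> 'a ^ 'n ^ 'n"
  where "vec_vec_star y = (\<chi> j k. y $ j * star (y $ k))"

end

theory Submission
  imports Defs
begin

text \<open>
  Call \<open>\<Sum>\<^sub>i v\<^sub>i v\<^sub>i\<^sup>*\<close> the Gram sum of a finite family of vectors. Over a commutative algebra every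
  matrix whose positivity is claimed is a Gram sum. Write \<open>a\<^sub>p\<close> and \<open>b\<^sub>q\<close> for the columns of \<open>A\<close> and
  \<open>B\<close>. Then the Schur product of \<open>A A\<^sup>*\<close> and \<open>B B\<^sup>*\<close> is the Gram sum of the entrywise products
  \<open>a\<^sub>p b\<^sub>q\<close> over all pairs \<open>(p, q)\<close>. The diagonal pairs give the columns of the Schur product \<open>C\<close> of
  \<open>A\<close> and \<open>B\<close>, hence \<open>C C\<^sup>*\<close>, so the first difference is the Gram sum over the pairs with
  \<open>p \<noteq> q\<close> (\<open>schur_prod_diff_nth\<close>). The second difference is a variance: it is the Gram sum of
  the columns of \<open>C\<close> after their mean \<open>y/n\<close> has been subtracted
  (\<open>mult_mat_star_diff_row_sums_nth\<close>).

  The quadratic form of a Gram sum is a finite sum of elements \<open>w w\<^sup>*\<close> (\<open>positive_mat_gram\<close>), so it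
  remains to see that such a sum is selfadjoint with nonnegative spectrum. The argument avoids
  characters of the algebra. An element \<open>w w\<^sup>*\<close> is a sum of two squares of selfadjoint elements,
  and after scaling such a square satisfies \<open>\<parallel>1 - h\<^sup>2\<parallel> \<le> 1\<close>, because \<open>h\<close> is the real part of the
  unitary \<open>h + \<i> sqrt (1 - h\<^sup>2)\<close> (\<open>norm_one_minus_square_le\<close>). The condition that
  \<open>\<parallel>t - a\<parallel> \<le> t\<close> for some \<open>t\<close> passes to sums, and for selfadjoint \<open>a\<close>, whose spectrum is real, it
  forces the spectrum to be nonnegative (\<open>norm_positive_imp_positive_elem\<close>).
\<close>

section \<open>The involution and the complex scalars\<close>

lemma scaleC_zero_left: "0 *\<^sub>C (x::'a::cstar_algebra) = 0"
  using scaleC_add_left[of 0 0 x] by simp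

lemma scaleC_one: "1 *\<^sub>C (x::'a::cstar_algebra) = x"
  using scaleR_scaleC[of 1 x] by simp

lemma scaleC_minus_left: "(- c) *\<^sub>C (x::'a::cstar_algebra) = - (c *\<^sub>C x)"
  using scaleC_add_left[of c "- c" x] by (simp add: scaleC_zero_left eq_neg_iff_add_eq_0 add.commute)

lemma scaleC_minus_one: "(- 1) *\<^sub>C (x::'a::cstar_algebra) = - x"
  by (simp add: scaleC_minus_left scaleC_one)

lemma scaleC_minus_right: "c *\<^sub>C (- x) = - (c *\<^sub>C (x::'a::cstar_algebra))"
  by (metis scaleC_minus_one scaleC_scaleC mult.commute)

lemma scaleC_diff_right: "c *\<^sub>C (x - y) = c *\<^sub>C x - c *\<^sub>C (y::'a::cstar_algebra)"
  using scaleC_add_right[of c x "- y"] by (simp add: scaleC_minus_right)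

lemma star_scaleR: "star (r *\<^sub>R x) = r *\<^sub>R star (x::'a::cstar_algebra)"
  by (simp add: scaleR_scaleC star_scaleC)

lemma star_zero: "star (0::'a::cstar_algebra) = 0"
  using star_scaleR[of 0 0] by simp

lemma star_minus: "star (- x) = - star (x::'a::cstar_algebra)"
  using star_scaleR[of "-1" x] by simp

lemma star_diff: "star (x - y) = star x - star (y::'a::cstar_algebra)"
  using star_add[of x "- y"] by (simp add: star_minus)

lemma star_one: "star (1::'a::cstar_algebra) = 1"
  by (metis mult_1_left mult_1_right star_mult star_star)

lemma star_power: "star (x ^ n) = star (x::'a::cstar_algebra) ^ n"
  by (induction n) (simp_all add: star_one star_mult power_commutes)

lemma star_sum: "star (\<Sum>i\<in>I. f i) = (\<Sum>i\<in>I. star (f i :: 'a::cstar_algebra))"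
  by (induction I rule: infinite_finite_induct) (simp_all add: star_zero star_add)

lemma norm_star: "norm (star x) = norm (x::'a::cstar_algebra)"
proof -
  have le: "norm y \<le> norm (star y)" for y :: 'a
  proof (cases "norm y = 0")
    case False
    have "norm y * norm y \<le> norm (star y) * norm y"
      using cstar_identity[of y] norm_mult_ineq[of "star y" y] by (simp add: power2_eq_square)
    with False show ?thesis by simp
  qed simp
  show ?thesis using le[of x] le[of "star x"] by (simp add: star_star)
qed

lemma bounded_linear_star: "bounded_linear (star :: 'a::cstar_algebra \<Rightarrow> 'a)"
  by (rule bounded_linear_intro[of _ 1]) (simp_all add: star_add star_scaleR norm_star)


section \<open>The spectrum of a selfadjoint element\<close>

lemma invertible_one_minus:
  fixes c :: "'a::{real_normed_algebra_1,banach}"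
  assumes "norm c < 1"
  shows "\<exists>b. (1 - c) * b = 1 \<and> b * (1 - c) = 1"
proof -
  have summ: "summable (\<lambda>n. c ^ n)"
    by (rule complete_algebra_summable_geometric[OF assms])
  define b where "b = (\<Sum>n. c ^ n)"
  have tail: "(\<Sum>n. c ^ Suc n) = b - 1"
    using suminf_split_head[OF summ] by (simp add: b_def)
  have "c * b = b - 1"
    using suminf_mult[OF summ, of c] tail by (simp add: b_def)
  moreover have "b * c = b - 1"
    using suminf_mult2[OF summ, of c] tail by (simp add: b_def power_commutes)
  ultimately show ?thesis
    by (intro exI[of _ b]) (simp add: algebra_simps)
qed

lemma spectrum_norm_bound:
  fixes a :: "'a::cstar_algebra"
  assumes "z \<in> spectrum a"
  shows "cmod z \<le> norm a"
proof (rule ccontr)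
  assume "\<not> cmod z \<le> norm a"
  hence less: "norm a < cmod z" by simp
  hence z: "z \<noteq> 0" by (metis norm_zero norm_not_less_zero)
  have "norm ((1 / z) *\<^sub>C a) < 1"
    using less z by (simp add: norm_scaleC norm_divide field_simps)
  then obtain b where b: "(1 - (1 / z) *\<^sub>C a) * b = 1" "b * (1 - (1 / z) *\<^sub>C a) = 1"
    using invertible_one_minus by blast
  have eq: "a - z *\<^sub>C 1 = (- z) *\<^sub>C (1 - (1 / z) *\<^sub>C a)"
    using z by (simp add: scaleC_diff_right scaleC_scaleC scaleC_minus_left scaleC_one)
  have "(a - z *\<^sub>C 1) * ((- 1 / z) *\<^sub>C b) = 1 \<and> ((- 1 / z) *\<^sub>C b) * (a - z *\<^sub>C 1) = 1"
    unfolding eq mult_scaleC_left mult_scaleC_right scaleC_scaleC b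
    using z by (simp add: scaleC_one)
  with assms show False unfolding spectrum_def by blast
qed

lemma spectrum_shift:
  fixes a :: "'a::cstar_algebra"
  shows "z \<in> spectrum a \<longleftrightarrow> z + w \<in> spectrum (a + w *\<^sub>C 1)"
  by (simp add: spectrum_def scaleC_add_left)

lemma spectrum_reflect:
  fixes a :: "'a::cstar_algebra"
  assumes "z \<in> spectrum a"
  shows "w - z \<in> spectrum (w *\<^sub>C 1 - a)"
proof (rule ccontr)
  assume "w - z \<notin> spectrum (w *\<^sub>C 1 - a)"
  moreover have "w *\<^sub>C 1 - a - (w - z) *\<^sub>C 1 = - (a - z *\<^sub>C (1::'a))"
    using scaleC_add_left[of w "- z" "1::'a"] by (simp add: scaleC_minus_left)
  ultimately obtain b where "- (a - z *\<^sub>C 1) * b = 1" "b * - (a - z *\<^sub>C 1) = 1"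
    unfolding spectrum_def by auto
  hence "(a - z *\<^sub>C 1) * (- b) = 1 \<and> (- b) * (a - z *\<^sub>C 1) = 1"
    by (metis minus_mult_commute)
  with assms show False unfolding spectrum_def by blast
qed

text \<open>
  A long imaginary shift detects imaginary parts: if \<open>z\<close> is in the spectrum of \<open>h\<close>, then
  \<open>z + \<i> t\<close> is in the spectrum of \<open>h + \<i> t\<close>, whose squared norm is at most
  \<open>\<parallel>h\<parallel>\<^sup>2 + t\<^sup>2\<close> by the C*-identity, while \<open>\<bar>z + \<i> t\<bar>\<^sup>2\<close> contains the
  term \<open>2 t Im z\<close>, which is linear in \<open>t\<close>.
\<close>

lemma spectrum_selfadjoint_real:
  fixes h :: "'a::cstar_algebra"
  assumes sa: "star h = h" and z: "z \<in> spectrum h"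
  shows "Im z = 0"
proof (rule ccontr)
  assume nz: "Im z \<noteq> 0"
  have bound: "2 * t * Im z \<le> (norm h)\<^sup>2" for t :: real
  proof -
    define w where "w = \<i> * complex_of_real t"
    define a where "a = h + w *\<^sub>C 1"
    have "star a * a = h * h + (t\<^sup>2) *\<^sub>R 1"
    proof -
      have "star a = h + (- w) *\<^sub>C 1"
        by (simp add: a_def star_add star_scaleC star_one sa w_def)
      hence "star a * a = h * h + (- (w * w)) *\<^sub>C 1"
        by (simp add: a_def distrib_left left_diff_distrib mult_scaleC_left mult_scaleC_right
            scaleC_minus_left scaleC_diff_right scaleC_scaleC)
      also have "- (w * w) = complex_of_real (t\<^sup>2)"
        by (simp add: w_def complex_eq_iff power2_eq_square)
      finally show ?thesis by (simp only: scaleR_scaleC)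
    qed
    hence "(norm a)\<^sup>2 = norm (h * h + (t\<^sup>2) *\<^sub>R (1::'a))"
      by (simp flip: cstar_identity)
    also have "\<dots> \<le> norm (h * h) + norm ((t\<^sup>2) *\<^sub>R (1::'a))"
      by (rule norm_triangle_ineq)
    also have "\<dots> \<le> (norm h)\<^sup>2 + t\<^sup>2"
      using norm_mult_ineq[of h h] by (simp add: power2_eq_square)
    finally have na: "(norm a)\<^sup>2 \<le> (norm h)\<^sup>2 + t\<^sup>2" .
    have "cmod (z + w) \<le> norm a"
      using z spectrum_norm_bound spectrum_shift unfolding a_def by blast
    hence "(cmod (z + w))\<^sup>2 \<le> (norm a)\<^sup>2"
      by (simp add: power_mono)
    moreover have "(cmod (z + w))\<^sup>2 = (Re z)\<^sup>2 + (Im z + t)\<^sup>2"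
      by (simp add: cmod_power2 w_def)
    ultimately have "(Re z)\<^sup>2 + (Im z + t)\<^sup>2 \<le> (norm h)\<^sup>2 + t\<^sup>2"
      using na by linarith
    moreover have "0 \<le> (Re z)\<^sup>2" "0 \<le> (Im z)\<^sup>2" by simp_all
    moreover have "(Im z + t)\<^sup>2 = (Im z)\<^sup>2 + 2 * t * Im z + t\<^sup>2"
      by (simp add: power2_sum)
    ultimately show ?thesis by linarith
  qed
  show False using bound[of "((norm h)\<^sup>2 + 1) / (2 * Im z)"] nz by simp
qed


section \<open>Positivity as a norm condition\<close>

text \<open>
  The spectral description of positivity is not visibly stable under addition. This norm
  description is, by the triangle inequality, and it implies the spectral one because reflecting
  the spectrum at \<open>t\<close> puts \<open>t - z\<close> within distance \<open>t\<close> of the origin.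
\<close>

definition norm_positive :: "'a::cstar_algebra \<Rightarrow> bool"
  where "norm_positive a \<longleftrightarrow> star a = a \<and> (\<exists>t. norm (t *\<^sub>R 1 - a) \<le> t)"

lemma norm_positive_imp_positive_elem:
  assumes "norm_positive a"
  shows "positive_elem a"
  unfolding positive_elem_def
proof (intro conjI subsetI)
  show sa: "star a = a" using assms by (simp add: norm_positive_def)
  obtain t where t: "norm (t *\<^sub>R 1 - a) \<le> t"
    using assms by (auto simp: norm_positive_def)
  fix z assume z: "z \<in> spectrum a"
  have Im: "Im z = 0" by (rule spectrum_selfadjoint_real[OF sa z])
  have "cmod (complex_of_real t - z) \<le> norm (t *\<^sub>R 1 - a)"
    using spectrum_norm_bound[OF spectrum_reflect[OF z]] by (simp add: scaleR_scaleC)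
  moreover have "\<bar>Re (complex_of_real t - z)\<bar> \<le> cmod (complex_of_real t - z)"
    by (rule abs_Re_le_cmod)
  ultimately have "0 \<le> Re z" using t by simp
  with Im show "z \<in> \<real>\<^sub>\<ge>\<^sub>0" by (simp add: complex_nonneg_Reals_iff)
qed

lemma norm_positive_zero: "norm_positive 0"
  unfolding norm_positive_def by (auto simp: star_zero intro!: exI[of _ 0])

lemma norm_positive_add:
  assumes "norm_positive a" and "norm_positive b"
  shows "norm_positive (a + b)"
proof -
  obtain s t where st: "norm (s *\<^sub>R 1 - a) \<le> s" "norm (t *\<^sub>R 1 - b) \<le> t"
    using assms by (auto simp: norm_positive_def)
  have "norm ((s + t) *\<^sub>R 1 - (a + b)) = norm ((s *\<^sub>R 1 - a) + (t *\<^sub>R 1 - b))"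
    by (simp add: scaleR_add_left algebra_simps)
  also have "\<dots> \<le> s + t"
    using st norm_triangle_ineq[of "s *\<^sub>R 1 - a" "t *\<^sub>R 1 - b"] by linarith
  finally show ?thesis
    using assms unfolding norm_positive_def by (auto simp: star_add)
qed

lemma norm_positive_sum:
  "(\<And>i. i \<in> I \<Longrightarrow> norm_positive (f i)) \<Longrightarrow> norm_positive (\<Sum>i\<in>I. f i)"
  by (induction I rule: infinite_finite_induct) (auto simp: norm_positive_zero norm_positive_add)

lemma norm_positive_scaleR:
  assumes "norm_positive a" and r: "0 \<le> r"
  shows "norm_positive (r *\<^sub>R a)"
proof -
  obtain t where t: "norm (t *\<^sub>R 1 - a) \<le> t"
    using assms by (auto simp: norm_positive_def)
  have "(r * t) *\<^sub>R 1 - r *\<^sub>R a = r *\<^sub>R (t *\<^sub>R 1 - a)"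
    by (simp add: scaleR_diff_right)
  hence "norm ((r * t) *\<^sub>R 1 - r *\<^sub>R a) \<le> r * t"
    using t r by (simp add: mult_left_mono)
  thus ?thesis
    using assms unfolding norm_positive_def by (auto simp: star_scaleR)
qed


section \<open>Squares of selfadjoint elements\<close>

text \<open>
  The binomial series for \<open>sqrt (1 + x)\<close> converges absolutely for \<open>\<parallel>x\<parallel> < 1\<close>, and
  squaring it collapses, by Vandermonde's identity for \<open>1/2 + 1/2 = 1\<close>, to \<open>1 + x\<close>. The two
  additional properties are inherited from the powers of \<open>x\<close>.
\<close>

lemma square_root_one_plus:
  fixes x :: "'a::cstar_algebra"
  assumes less: "norm x < 1" and sa: "star x = x"
  obtains s where "s * s = 1 + x" and "star s = s" and "\<And>h. h * x = x * h \<Longrightarrow> h * s = s * h"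
proof -
  define c :: "nat \<Rightarrow> real" where "c k = ((1 / 2) gchoose k)" for k
  define f where "f k = c k *\<^sub>R x ^ k" for k
  define s where "s = (\<Sum>k. f k)"
  have "conv_radius c \<ge> 1"
    unfolding c_def [abs_def] conv_radius_gchoose by simp
  moreover have "ereal (norm (norm x)) < 1"
    using less by simp
  ultimately have "ereal (norm (norm x)) < conv_radius c"
    by (rule less_le_trans[rotated])
  hence "summable (\<lambda>k. norm (c k * norm x ^ k))"
    by (rule abs_summable_in_conv_radius)
  hence abs: "summable (\<lambda>k. norm (f k))"
    by (rule summable_norm_comparison_test[rotated])
      (auto simp: f_def abs_mult intro!: mult_left_mono norm_power_ineq)
  hence summ: "summable f" by (rule summable_norm_cancel)
  have conv: "(\<Sum>i\<le>k. f i * f (k - i)) = (1 gchoose k) *\<^sub>R x ^ k" for k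
  proof -
    have "(\<Sum>i\<le>k. f i * f (k - i)) = (\<Sum>i\<le>k. (c i * c (k - i)) *\<^sub>R x ^ k)"
      by (intro sum.cong) (auto simp: f_def simp flip: power_add)
    also have "\<dots> = (\<Sum>i\<le>k. c i * c (k - i)) *\<^sub>R x ^ k"
      by (simp add: scaleR_sum_left)
    also have "(\<Sum>i\<le>k. c i * c (k - i)) = (1 gchoose k)"
      using gbinomial_Vandermonde[of "1/2::real" "1/2" k] by (simp add: c_def atLeast0AtMost)
    finally show ?thesis .
  qed
  have "s * s = (\<Sum>k. (1 gchoose k) *\<^sub>R x ^ k)"
    unfolding s_def Cauchy_product[OF abs abs] conv ..
  also have "\<dots> = (\<Sum>k<2. (1 gchoose k) *\<^sub>R x ^ k)"
  proof (rule suminf_finite)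
    fix k :: nat assume "k \<notin> {..<2}"
    hence "(1::real) gchoose k = 0"
      using binomial_gbinomial[of 1 k, where 'a = real] by (simp add: binomial_eq_0)
    thus "((1::real) gchoose k) *\<^sub>R x ^ k = 0" by simp
  qed simp
  also have "\<dots> = 1 + x" by (simp add: numeral_2_eq_2)
  finally have 1: "s * s = 1 + x" .
  have "star s = (\<Sum>k. star (f k))"
    unfolding s_def by (rule bounded_linear.suminf[OF bounded_linear_star summ])
  also have "\<dots> = s"
    by (simp add: s_def f_def star_scaleR star_power sa)
  finally have 2: "star s = s" .
  have 3: "h * s = s * h" if "h * x = x * h" for h
  proof -
    have "h * f k = f k * h" for k
      using power_commuting_commutes[of x h k] that by (simp add: f_def)
    thus ?thesis
      unfolding s_def suminf_mult[OF summ, symmetric] suminf_mult2[OF summ] by simp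
  qed
  show thesis by (rule that[OF 1 2 3])
qed

text \<open>
  The unit circle in algebraic form: with \<open>s = sqrt (1 - h\<^sup>2)\<close> the element \<open>u = h + \<i> s\<close> is
  unitary, so it has norm \<open>1\<close>; hence its imaginary part \<open>s\<close> has norm at most \<open>1\<close>, and so does
  \<open>s\<^sup>2 = 1 - h\<^sup>2\<close>.
\<close>

lemma norm_one_minus_square_le:
  fixes h :: "'a::cstar_algebra"
  assumes sa: "star h = h" and less: "norm h < 1"
  shows "norm (1 - h * h) \<le> 1"
proof -
  have "norm (h * h) < 1"
    using norm_mult_ineq[of h h] less mult_strict_mono'[of "norm h" 1 "norm h" 1] by simp
  then obtain s where s: "s * s = 1 - h * h" "star s = s" "h * s = s * h"
    using square_root_one_plus[of "- (h * h)"] sa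
    by (auto simp: star_minus star_mult mult.assoc)
  define u where "u = h + \<i> *\<^sub>C s"
  have star_u: "star u = h - \<i> *\<^sub>C s"
    by (simp add: u_def star_add star_scaleC sa s scaleC_minus_left)
  have "star u * u = h * h + s * s"
    unfolding star_u unfolding u_def
    by (simp add: left_diff_distrib distrib_left mult_scaleC_left mult_scaleC_right
        scaleC_diff_right scaleC_scaleC scaleC_minus_one s(3))
  hence "(norm u)\<^sup>2 = 1"
    using cstar_identity[of u] s(1) by simp
  hence u: "norm u = 1"
    by (simp add: power2_eq_1_iff) (metis norm_ge_zero not_one_le_zero neg_0_le_iff_le)
  have "2 * norm s = norm (\<i> *\<^sub>C s + \<i> *\<^sub>C s)"
    by (simp add: norm_scaleC flip: scaleC_add_left)
  also have "\<dots> = norm (u - star u)"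
    unfolding star_u unfolding u_def by simp
  also have "\<dots> \<le> 2"
    using norm_triangle_ineq4[of u "star u"] by (simp add: u norm_star)
  finally have "norm s \<le> 1" by simp
  hence "norm (s * s) \<le> 1"
    using norm_mult_ineq[of s s] mult_mono[of "norm s" 1 "norm s" 1] by simp
  with s(1) show ?thesis by simp
qed

lemma norm_positive_square:
  fixes h :: "'a::cstar_algebra"
  assumes sa: "star h = h"
  shows "norm_positive (h * h)"
proof -
  define r where "r = norm h + 1"
  have r: "r > 0" by (simp add: r_def add_nonneg_pos)
  define g where "g = (1 / r) *\<^sub>R h"
  have "norm g < 1" using r by (simp add: g_def r_def)
  moreover have g: "star g = g" by (simp add: g_def star_scaleR sa)
  ultimately have "norm (1 *\<^sub>R 1 - g * g) \<le> 1"
    using norm_one_minus_square_le by simp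
  hence "norm_positive (g * g)"
    using g unfolding norm_positive_def by (auto simp: star_mult intro!: exI[of _ 1])
  hence "norm_positive ((r * r) *\<^sub>R (g * g))"
    using r by (intro norm_positive_scaleR) simp_all
  moreover have "(r * r) *\<^sub>R (g * g) = h * h"
    using r by (simp add: g_def)
  ultimately show ?thesis by simp
qed

text \<open>
  Write \<open>z = h + \<i> k\<close> with selfadjoint \<open>h\<close> and \<open>k\<close>. Because \<open>h\<close> and \<open>k\<close> commute, the cross terms
  cancel and \<open>z z\<^sup>* = h\<^sup>2 + k\<^sup>2\<close>.
\<close>

lemma norm_positive_mult_star:
  fixes z :: "'a::comm_cstar_algebra"
  shows "norm_positive (z * star z)"
proof -
  define h where "h = (1 / 2) *\<^sub>R (z + star z)"
  define k where "k = (- \<i> / 2) *\<^sub>C (z - star z)"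
  have h: "star h = h"
    by (simp add: h_def star_scaleR star_add star_star add.commute)
  have "star k = (\<i> / 2) *\<^sub>C (star z - z)"
    by (simp add: k_def star_scaleC star_diff star_star)
  also have "\<dots> = k"
    unfolding k_def by (simp add: scaleC_diff_right scaleC_minus_left)
  finally have k: "star k = k" .
  have kk: "k * k = - (1 / 4) *\<^sub>R ((z - star z) * (z - star z))"
    unfolding k_def mult_scaleC_left mult_scaleC_right scaleC_scaleC scaleR_scaleC
    by (simp add: scaleC_minus_left)
  have hh: "h * h = (1 / 4) *\<^sub>R ((z + star z) * (z + star z))"
    by (simp add: h_def)
  have "h * h + k * k =
      (1 / 4) *\<^sub>R ((z + star z) * (z + star z) - (z - star z) * (z - star z))"
    unfolding hh kk by (simp add: scaleR_diff_right)
  also have "(z + star z) * (z + star z) - (z - star z) * (z - star z) = 4 *\<^sub>R (z * star z)"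
    by (simp add: algebra_simps scaleR_conv_of_real)
  finally have "h * h + k * k = z * star z" by simp
  thus ?thesis
    using norm_positive_add[OF norm_positive_square[OF h] norm_positive_square[OF k]] by simp
qed


section \<open>Gram sums of vectors\<close>

text \<open>
  A sum of rank one matrices \<open>v v\<^sup>*\<close> has the quadratic form \<open>\<Sum>\<^sub>i w\<^sub>i w\<^sub>i\<^sup>*\<close> with
  \<open>w\<^sub>i = \<Sum>\<^sub>j v\<^sub>i\<^sub>j x\<^sub>j\<^sup>*\<close>.
\<close>

lemma positive_mat_gram:
  fixes P :: "'a::comm_cstar_algebra ^ 'n ^ 'n" and v :: "'i \<Rightarrow> 'n \<Rightarrow> 'a"
  assumes P: "\<And>j k. P $ j $ k = (\<Sum>i\<in>I. v i j * star (v i k))"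
  shows "positive_mat P"
  unfolding positive_mat_def
proof (intro conjI allI)
  show "P = mat_star P"
    by (simp add: vec_eq_iff mat_star_def P star_sum star_mult star_star mult.commute)
  fix x :: "'a ^ 'n"
  define w where "w i = (\<Sum>j\<in>UNIV. v i j * star (x $ j))" for i
  have ww: "w i * star (w i) =
      (\<Sum>j\<in>UNIV. \<Sum>k\<in>UNIV. v i j * star (v i k) * x $ k * star (x $ j))" for i
    unfolding w_def star_sum sum_product
    by (intro sum.cong refl) (simp add: star_mult star_star mult_ac)
  have "inner_A (P *v x) x =
      (\<Sum>j\<in>UNIV. \<Sum>k\<in>UNIV. \<Sum>i\<in>I. v i j * star (v i k) * x $ k * star (x $ j))"
    by (simp add: inner_A_def matrix_vector_mult_def P sum_distrib_right)
  also have "\<dots> = (\<Sum>j\<in>UNIV. \<Sum>i\<in>I. \<Sum>k\<in>UNIV. v i j * star (v i k) * x $ k * star (x $ j))"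
    by (intro sum.cong refl) (rule sum.swap)
  also have "\<dots> = (\<Sum>i\<in>I. w i * star (w i))"
    unfolding ww by (rule sum.swap)
  finally show "positive_elem (inner_A (P *v x) x)"
    by (simp add: norm_positive_imp_positive_elem norm_positive_sum norm_positive_mult_star)
qed

lemma mult_mat_star_nth:
  "(C ** mat_star C) $ j $ k = (\<Sum>p\<in>UNIV. C $ j $ p * star (C $ k $ p))"
  by (simp add: matrix_matrix_mult_def mat_star_def)

lemma schur_prod_nth:
  fixes A B :: "'a::comm_cstar_algebra ^ 'n ^ 'n"
  shows "(A \<circ>\<^sub>S B) $ j $ k = A $ j $ k * B $ j $ k"
proof -
  have "(A \<circ>\<^sub>S B) $ j $ k = (1 / 2) *\<^sub>R (A $ j $ k * B $ j $ k + A $ j $ k * B $ j $ k)"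
    by (simp add: schur_prod_def mult.commute)
  thus ?thesis by (simp flip: scaleR_2)
qed

text \<open>
  Expanding the product of the two sums gives vectors indexed by all pairs of columns, where
  \<open>(p, q)\<close> stands for the entrywise product of column \<open>p\<close> of \<open>A\<close> with column \<open>q\<close> of \<open>B\<close>.
\<close>

lemma schur_prod_mult_mat_star_nth:
  fixes A B :: "'a::comm_cstar_algebra ^ 'n ^ 'n"
  shows "((A ** mat_star A) \<circ>\<^sub>S (B ** mat_star B)) $ j $ k =
    (\<Sum>(p, q)\<in>UNIV. (A $ j $ p * B $ j $ q) * star (A $ k $ p * B $ k $ q))"
  unfolding schur_prod_nth mult_mat_star_nth sum_product
  by (simp add: sum.cartesian_product star_mult mult_ac)

text \<open>
  The columns of the Schur product are the diagonal pairs, so the difference keeps the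
  off-diagonal ones.
\<close>

lemma schur_prod_diff_nth:
  fixes A B :: "'a::comm_cstar_algebra ^ 'n ^ 'n"
  shows "((A ** mat_star A) \<circ>\<^sub>S (B ** mat_star B)
      - (A \<circ>\<^sub>S B) ** mat_star (A \<circ>\<^sub>S B)) $ j $ k =
    (\<Sum>(p, q)\<in>- range (\<lambda>p. (p, p)). (A $ j $ p * B $ j $ q) * star (A $ k $ p * B $ k $ q))"
proof -
  define f where "f = (\<lambda>(p, q). (A $ j $ p * B $ j $ q) * star (A $ k $ p * B $ k $ q))"
  have "sum f UNIV = sum f (- range (\<lambda>p. (p, p))) + sum f (range (\<lambda>p. (p, p)))"
    using sum.subset_diff[of "range (\<lambda>p. (p, p))" UNIV f] by (simp add: Compl_eq_Diff_UNIV)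
  also have "sum f (range (\<lambda>p. (p, p))) = ((A \<circ>\<^sub>S B) ** mat_star (A \<circ>\<^sub>S B)) $ j $ k"
    by (subst sum.reindex) (auto simp: inj_on_def mult_mat_star_nth schur_prod_nth f_def)
  finally show ?thesis
    by (simp add: schur_prod_mult_mat_star_nth f_def)
qed

text \<open>
  This is the variance identity: subtracting the mean \<open>y/n\<close> from each of the \<open>n\<close> columns \<open>c\<close> of
  \<open>C\<close> lowers \<open>\<Sum> c c\<^sup>*\<close> by \<open>y y\<^sup>* / n\<close>, since the columns add up to \<open>y\<close>.
\<close>

lemma mult_mat_star_diff_row_sums_nth:
  fixes C :: "'a::comm_cstar_algebra ^ 'n ^ 'n"
  defines "y \<equiv> row_sums C" and "m \<equiv> \<lambda>j. (1 / real CARD('n)) *\<^sub>R row_sums C $ j"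
  shows "(C ** mat_star C - (1 / real CARD('n)) *\<^sub>R vec_vec_star y) $ j $ k =
    (\<Sum>p\<in>UNIV. (C $ j $ p - m j) * star (C $ k $ p - m k))"
proof -
  have y: "(\<Sum>p\<in>UNIV. C $ i $ p) = y $ i" for i
    by (simp add: y_def row_sums_def)
  have const: "(\<Sum>p\<in>(UNIV::'n set). c) = real CARD('n) *\<^sub>R c" for c :: 'a
    by (rule sum_constant_scaleR)
  have "(\<Sum>p\<in>UNIV. (C $ j $ p - m j) * star (C $ k $ p - m k)) =
      (\<Sum>p\<in>UNIV. C $ j $ p * star (C $ k $ p)) - (\<Sum>p\<in>UNIV. C $ j $ p) * star (m k)
      - m j * star (\<Sum>p\<in>UNIV. C $ k $ p) + real CARD('n) *\<^sub>R (m j * star (m k))"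
    by (simp add: star_diff left_diff_distrib right_diff_distrib sum.distrib sum_subtractf
        star_sum const sum_distrib_left sum_distrib_right del: sum_constant)
  also have "\<dots> = (\<Sum>p\<in>UNIV. C $ j $ p * star (C $ k $ p))
      - (1 / real CARD('n)) *\<^sub>R (y $ j * star (y $ k))"
    by (simp add: y m_def star_scaleR flip: y_def)
  finally show ?thesis
    by (simp add: mult_mat_star_nth vec_vec_star_def)
qed

lemma positive_mat_mult_mat_star:
  fixes C :: "'a::comm_cstar_algebra ^ 'n ^ 'n"
  shows "positive_mat (C ** mat_star C)"
  by (rule positive_mat_gram) (rule mult_mat_star_nth)

lemma positive_mat_vec_vec_star:
  fixes y :: "'a::comm_cstar_algebra ^ 'n"
  assumes "0 \<le> r"
  shows "positive_mat (r *\<^sub>R vec_vec_star y)"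
proof (rule positive_mat_gram)
  show "(r *\<^sub>R vec_vec_star y) $ j $ k =
      (\<Sum>i\<in>{()}. (sqrt r *\<^sub>R y $ j) * star (sqrt r *\<^sub>R y $ k))" for j k
    using assms by (simp add: vec_vec_star_def star_scaleR)
qed

theorem theorem3p2:
  fixes M N A B :: "'a::comm_cstar_algebra ^ 'n ^ 'n"
    and y :: "'a ^ 'n"
  assumes "positive_mat M" and "positive_mat N"
    and "M = A ** mat_star A" and "N = B ** mat_star B"
    and "y = row_sums (A \<circ>\<^sub>S B)"
  shows "M \<circ>\<^sub>S N \<succeq> (A \<circ>\<^sub>S B) ** mat_star (A \<circ>\<^sub>S B) \<and>
         (A \<circ>\<^sub>S B) ** mat_star (A \<circ>\<^sub>S B) \<succeq> (1 / real CARD('n)) *\<^sub>R vec_vec_star y"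
proof -
  have "positive_mat (M \<circ>\<^sub>S N)"
    by (rule positive_mat_gram[where I = UNIV and v = "\<lambda>(p, q) j. A $ j $ p * B $ j $ q"])
      (simp add: assms(3,4) schur_prod_mult_mat_star_nth case_prod_unfold)
  moreover have "positive_mat (M \<circ>\<^sub>S N - (A \<circ>\<^sub>S B) ** mat_star (A \<circ>\<^sub>S B))"
    unfolding assms(3,4)
    by (rule positive_mat_gram[where I = "- range (\<lambda>p. (p, p))"
            and v = "\<lambda>(p, q) j. A $ j $ p * B $ j $ q"])
      (simp only: schur_prod_diff_nth case_prod_unfold)
  moreover have "positive_mat ((A \<circ>\<^sub>S B) ** mat_star (A \<circ>\<^sub>S B)
      - (1 / real CARD('n)) *\<^sub>R vec_vec_star y)"
    unfolding assms(5) by (rule positive_mat_gram) (rule mult_mat_star_diff_row_sums_nth)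
  ultimately show ?thesis
    by (simp add: mat_succeq_def positive_mat_mult_mat_star positive_mat_vec_vec_star)
qed

end
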